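(* Let $\{\widehat\theta_N\}_{N=1}^\infty\subseteq S$ be a sequence of hyper-parameter estimates, for some compact set $S\subseteq R_\theta$. Assume: (a) $U\subseteq\mathbb R^{d_u}$ is compact; (b) $\sup_{u\in U}\|\mathcal G(u)-m_N^{\mathcal G}(\widehat\theta_N;u)\|$ and $\sup_{u\in U}|\Phi(u)-m_N^\Phi(\widehat\theta_N;u)|$ can be bounded uniformly in $N$; (c) $\sup_{u\in U}\|\mathcal G(u)\|\le C_{\mathcal G}<\infty$. Then there exist constants $C_1$ and $C_2$, independent of $N$, such that $$d_{\mathrm{Hell}}\big(\mu^y,\mu^{y,N,\mathcal G,\widehat\theta_N}_{\mathrm{mean}}\big)\le C_1\big\|\mathcal G-m_N^{\mathcal G}(\widehat\theta_N)\big\|_{L^2_{\mu_0}(U;\mathbb R^{d_y})}$$ and $$d_{\mathrm{Hell}}\big(\mu^y,\mu^{y,N,\Phi,\widehat\theta_N}_{\mathrm{mean}}\big)\le C_2\big\|\Phi-m_N^\Phi(\widehat\theta_N)\big\|_{L^2_{\mu_0}(U)}.$$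
   Context: Bayesian inverse problem: data $y\in\mathbb R^{d_y}$ is given by $y=\mathcal G(u)+\eta$ with forward map $\mathcal G:U\to\mathbb R^{d_y}$ and Gaussian noise $\eta\sim\mathcal N(0,\Gamma)$, $\Gamma$ a known positive-definite covariance matrix. $\mu_0$ is a prior probability measure with $\mu_0(U)=1$. With $\|x\|_\Gamma^2=x^T\Gamma^{-1}x$ and $\Phi(u)=\frac12\|y-\mathcal G(u)\|_\Gamma^2$, the posterior $\mu^y$ is $$\frac{d\mu^y}{d\mu_0}(u)=\frac1Z\exp(-\Phi(u)),\qquad Z=\mathbb E_{\mu_0}(\exp(-\Phi)).$$ Gaussian process emulators: for a scalar function $g:U\to\mathbb R$, prior mean $m(\theta;\cdot)$ and positive-definite covariance kernel $k(\theta;\cdot,\cdot)$ on $U$ depending on hyper-parameters $\theta\in R_\theta\subseteq\mathbb R^{d_\theta}$, and distinct design points $D_N=\{u^1,\dots,u^N\}\subseteq U$, the predictive mean is $$m_N^g(\theta;u)=m(\theta;u)+k(\theta;u,D_N)^TK(\theta;D_N)^{-1}\big(g(D_N)-m(\theta;D_N)\big),$$ where $g(D_N)=[g(u^1),\dots,g(u^N)]$, $m(\theta;D_N)=[m(\theta;u^n)]_{n}$, $k(\theta;u,D_N)=[k(\theta;u,u^n)]_n$, $K(\theta;D_N)_{ij}=k(\theta;u^i,u^j)$. For the vector-valued map, $m_N^{\mathcal G}(\theta;u)=[m_N^{\mathcal G^1}(\theta;u),\dots,m_N^{\mathcal G^{d_y}}(\theta;u)]$. All functions of $u$ ($\mathcal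 G$, $m(\theta)$, $k(\theta)$) are taken to be measurable. Approximate posteriors: $$\frac{d\mu^{y,N,\mathcal G,\theta}_{\mathrm{mean}}}{d\mu_0}(u)=\frac{1}{Z^{N,\mathcal G,\theta}_{\mathrm{mean}}}\exp\big(-\tfrac12\|y-m_N^{\mathcal G}(\theta;u)\|_\Gamma^2\big),\qquad \frac{d\mu^{y,N,\Phi,\theta}_{\mathrm{mean}}}{d\mu_0}(u)=\frac{1}{Z^{N,\Phi,\theta}_{\mathrm{mean}}}\exp\big(-m_N^\Phi(\theta;u)\big),$$ where $Z^{N,\mathcal G,\theta}_{\mathrm{mean}}$, $Z^{N,\Phi,\theta}_{\mathrm{mean}}$ are the normalising constants (the $\mu_0$-expectations of the exponentials). $d_{\mathrm{Hell}}$ is the Hellinger distance: $d_{\mathrm{Hell}}(\mu,\mu')^2=\frac12\int_U\big(\sqrt{d\mu/d\mu_0}-\sqrt{d\mu'/d\mu_0}\big)^2d\mu_0$. *)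

theory Defs
  imports "HOL-Probability.Probability" "Jordan_Normal_Form.Gauss_Jordan_Elimination"
begin

text \<open>
  The functions on \<open>U\<close> are total functions of which only the values on \<open>U\<close> matter;
  the prior is a Borel probability measure on the ambient space that gives \<open>U\<close> mass one.
\<close>

definition posdef_matrix :: "real ^ 'n ^ 'n \<Rightarrow> bool" where
  "posdef_matrix A \<longleftrightarrow> transpose A = A \<and> (\<forall>x. x \<noteq> 0 \<longrightarrow> inner x (A *v x) > 0)"

definition weighted_norm_sq :: "real ^ 'n ^ 'n \<Rightarrow> real ^ 'n \<Rightarrow> real" where
  "weighted_norm_sq \<Gamma> x = inner x (matrix_inv \<Gamma> *v x)"

definition misfit :: "real ^ 'n ^ 'n \<Rightarrow> real ^ 'n \<Rightarrow> ('u \<Rightarrow> real ^ 'n) \<Rightarrow> 'u \<Rightarrow> real" where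
  "misfit \<Gamma> y F u = 1 / 2 * weighted_norm_sq \<Gamma> (y - F u)"

text \<open>
  Positive-definite covariance kernel in the strict sense: the Gram matrix of every finite set of
  distinct points of \<open>U\<close> is symmetric positive definite, hence invertible.
\<close>

definition posdef_kernel_on :: "'u set \<Rightarrow> ('u \<Rightarrow> 'u \<Rightarrow> real) \<Rightarrow> bool" where
  "posdef_kernel_on U k \<longleftrightarrow>
     (\<forall>u\<in>U. \<forall>v\<in>U. k u v = k v u) \<and>
     (\<forall>A c. finite A \<and> A \<subseteq> U \<and> (\<exists>a\<in>A. c a \<noteq> 0) \<longrightarrow>
        (\<Sum>u\<in>A. \<Sum>v\<in>A. c u * c v * k u v) > 0)"

definition gram_matrix :: "('u \<Rightarrow> 'u \<Rightarrow> real) \<Rightarrow> nat \<Rightarrow> (nat \<Rightarrow> 'u) \<Rightarrow> real mat" where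
  "gram_matrix k N d = Matrix.mat N N (\<lambda>(i, j). k (d i) (d j))"

text \<open>
  Predictive mean of the emulator of \<open>g\<close> with the \<open>N\<close> design points \<open>d 0, \<dots>, d (N - 1)\<close>.
  For a positive-definite kernel and distinct design points in \<open>U\<close> the Gram matrix is invertible,
  so \<^const>\<open>mat_inverse\<close> does not return \<^const>\<open>None\<close>.
\<close>

definition gp_mean ::
  "('u \<Rightarrow> real) \<Rightarrow> ('u \<Rightarrow> 'u \<Rightarrow> real) \<Rightarrow> nat \<Rightarrow> (nat \<Rightarrow> 'u) \<Rightarrow> ('u \<Rightarrow> real) \<Rightarrow> 'u \<Rightarrow> real" where
  "gp_mean m k N d g u =
     m u + scalar_prod (Matrix.vec N (\<lambda>n. k u (d n)))
       (the (mat_inverse (gram_matrix k N d)) *\<^sub>v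
         (Matrix.vec N (\<lambda>n. g (d n)) - Matrix.vec N (\<lambda>n. m (d n))))"

definition gp_mean_vec ::
  "('u \<Rightarrow> real) \<Rightarrow> ('u \<Rightarrow> 'u \<Rightarrow> real) \<Rightarrow> nat \<Rightarrow> (nat \<Rightarrow> 'u) \<Rightarrow>
    ('u \<Rightarrow> real ^ 'n) \<Rightarrow> 'u \<Rightarrow> real ^ 'n" where
  "gp_mean_vec m k N d G u = (\<chi> j. gp_mean m k N d (\<lambda>v. vec_nth (G v) j) u)"

definition norm_const :: "'u set \<Rightarrow> 'u measure \<Rightarrow> ('u \<Rightarrow> real) \<Rightarrow> real" where
  "norm_const U \<mu>0 \<Psi> = (LINT u:U|\<mu>0. exp (- \<Psi> u))"

definition posterior :: "'u set \<Rightarrow> 'u measure \<Rightarrow> ('u \<Rightarrow> real) \<Rightarrow> 'u measure" where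
  "posterior U \<mu>0 \<Psi> =
     density \<mu>0 (\<lambda>u. ennreal (indicator U u * (1 / norm_const U \<mu>0 \<Psi> * exp (- \<Psi> u))))"

definition hellinger_dist :: "'u set \<Rightarrow> 'u measure \<Rightarrow> 'u measure \<Rightarrow> 'u measure \<Rightarrow> real" where
  "hellinger_dist U \<mu>0 \<mu> \<nu> =
     sqrt (1 / 2 * (LINT u:U|\<mu>0.
       (sqrt (enn2real (RN_deriv \<mu>0 \<mu> u)) - sqrt (enn2real (RN_deriv \<mu>0 \<nu> u)))\<^sup>2))"

definition L2_norm_on :: "'u set \<Rightarrow> 'u measure \<Rightarrow> ('u \<Rightarrow> 'b::real_normed_vector) \<Rightarrow> real" where
  "L2_norm_on U \<mu>0 f = sqrt (LINT u:U|\<mu>0. (norm (f u))\<^sup>2)"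

end

theory Submission
  imports Defs "Jordan_Normal_Form.Determinant"
begin

text \<open>
  Absorbing the normalising constant \<open>Z\<close> into the potential turns the density into
  \<open>exp (- (\<Psi> + ln Z))\<close>, so the Hellinger distance compares exponentials of half the normalised
  potentials. On a bounded range \<open>exp\<close> and \<open>ln\<close> are Lipschitz, and \<open>|Z - Z'|\<close> is bounded by the
  \<open>L1\<close>, hence by the \<open>L2\<close> distance of the potentials; this bounds the Hellinger distance by the
  \<open>L2\<close> distance of the potentials, with a constant depending only on a uniform bound for them.
  The statement for emulated forward maps follows since the misfit is Lipschitz on bounded sets.
\<close>

section \<open>Lipschitz bounds for the exponential and the logarithm\<close>

text \<open>Factoring out the larger exponential leaves \<open>1 - exp (s - t)\<close>, which the
  tangent inequality \<open>1 + x \<le> exp x\<close> bounds by \<open>t - s\<close>.\<close>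

lemma abs_exp_diff_le:
  fixes a b c :: real
  assumes "a \<le> c" "b \<le> c"
  shows "\<bar>exp a - exp b\<bar> \<le> exp c * \<bar>a - b\<bar>"
proof -
  have *: "exp t - exp s \<le> exp c * (t - s)" if "s \<le> t" "t \<le> c" for s t :: real
  proof -
    have "exp t * (1 - exp (s - t)) \<le> exp t * (t - s)"
    proof (intro mult_left_mono)
      show "1 - exp (s - t) \<le> t - s"
        using exp_ge_add_one_self[of "s - t"] by linarith
    qed simp
    also have "\<dots> \<le> exp c * (t - s)"
      using that by (intro mult_right_mono) auto
    also have "exp t * (1 - exp (s - t)) = exp t - exp s"
      by (simp add: algebra_simps flip: exp_add)
    finally show ?thesis .
  qed
  show ?thesis
  proof (cases "a \<le> b")
    case True
    then show ?thesis
      using *[of a b] assms by (simp add: abs_if)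
  next
    case False
    then show ?thesis
      using *[of b a] assms by (simp add: abs_if)
  qed
qed

text \<open>The difference is the logarithm of a quotient, to which \<open>ln x \<le> x - 1\<close>
  applies; the lower bound \<open>c\<close> then replaces the denominator.\<close>

lemma abs_ln_diff_le:
  fixes x y c :: real
  assumes "0 < c" "c \<le> x" "c \<le> y"
  shows "\<bar>ln x - ln y\<bar> \<le> \<bar>x - y\<bar> / c"
proof -
  have *: "ln t - ln s \<le> (t - s) / c" if "c \<le> s" "s \<le> t" for s t :: real
  proof -
    have "ln t - ln s = ln (t / s)"
      using that assms by (simp add: ln_div)
    also have "\<dots> \<le> t / s - 1"
      using that assms by (intro ln_le_minus_one) auto
    also have "\<dots> = (t - s) / s"
      using that assms by (simp add: field_simps)
    also have "\<dots> \<le> (t - s) / c"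
      using that assms by (intro divide_left_mono) auto
    finally show ?thesis .
  qed
  have mono: "ln s \<le> ln t" if "c \<le> s" "s \<le> t" for s t :: real
    using that assms by simp
  show ?thesis
  proof (cases "x \<le> y")
    case True
    then show ?thesis
      using *[of x y] mono[of x y] assms by (simp add: abs_if)
  next
    case False
    then show ?thesis
      using *[of y x] mono[of y x] assms by (simp add: abs_if)
  qed
qed

section \<open>Hellinger integrals over a probability space\<close>

lemma (in prob_space) integrable_bounded:
  fixes f :: "'a \<Rightarrow> real"
  assumes "f \<in> borel_measurable M" "\<And>x. x \<in> space M \<Longrightarrow> \<bar>f x\<bar> \<le> B"
  shows "integrable M f"
  using assms by (intro integrable_const_bound[where B = B]) auto

text \<open>This is nonnegativity of the variance. It serves to trade a squared L1 norm for a
  squared L2 norm.\<close>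

lemma (in prob_space) square_expectation_le:
  fixes f :: "'a \<Rightarrow> real"
  assumes "integrable M f" "integrable M (\<lambda>x. (f x)\<^sup>2)"
  shows "(expectation f)\<^sup>2 \<le> expectation (\<lambda>x. (f x)\<^sup>2)"
  using variance_eq[OF assms] variance_positive[of f] by simp

text \<open>In the constant, \<open>exp (2 * B)\<close> is the squared Lipschitz constant of
  \<open>exp\<close> for exponents up to \<open>B\<close>. The summand \<open>1\<close> belongs to
  the pointwise difference of the potentials, \<open>exp (4 * B)\<close> to the difference of the
  logarithms of the normalising constants.\<close>

lemma (in prob_space) hellinger_integral_le:
  fixes \<Psi> \<Psi>' :: "'a \<Rightarrow> real" and B :: real
  defines "Z \<equiv> expectation (\<lambda>x. exp (- \<Psi> x))" and "Z' \<equiv> expectation (\<lambda>x. exp (- \<Psi>' x))"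
  assumes meas [measurable]: "\<Psi> \<in> borel_measurable M" "\<Psi>' \<in> borel_measurable M"
    and bound: "\<And>x. x \<in> space M \<Longrightarrow> \<bar>\<Psi> x\<bar> \<le> B" "\<And>x. x \<in> space M \<Longrightarrow> \<bar>\<Psi>' x\<bar> \<le> B"
  shows "expectation (\<lambda>x. (sqrt (exp (- \<Psi> x) / Z) - sqrt (exp (- \<Psi>' x) / Z'))\<^sup>2)
    \<le> exp (2 * B) * (1 + exp (4 * B)) * expectation (\<lambda>x. (\<Psi> x - \<Psi>' x)\<^sup>2)"
proof -
  define I where "I = expectation (\<lambda>x. \<bar>\<Psi> x - \<Psi>' x\<bar>)"
  have diff_bound: "\<bar>\<Psi> x - \<Psi>' x\<bar> \<le> 2 * B" if "x \<in> space M" for x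
    using bound[OF that] by linarith
  have int_diff: "integrable M (\<lambda>x. \<bar>\<Psi> x - \<Psi>' x\<bar>)"
    using diff_bound by (intro integrable_bounded[where B = "2 * B"]) auto
  have int_diff2: "integrable M (\<lambda>x. (\<Psi> x - \<Psi>' x)\<^sup>2)"
  proof (rule integrable_bounded)
    show "\<bar>(\<Psi> x - \<Psi>' x)\<^sup>2\<bar> \<le> (2 * B)\<^sup>2" if "x \<in> space M" for x
      using power_mono[OF diff_bound[OF that] abs_ge_zero, of 2] by simp
  qed measurable
  have int_exp: "integrable M (\<lambda>x. exp (- f x))"
    and exp_range: "exp (- B) \<le> expectation (\<lambda>x. exp (- f x))"
      "expectation (\<lambda>x. exp (- f x)) \<le> exp B"
    if [measurable]: "f \<in> borel_measurable M" and "\<And>x. x \<in> space M \<Longrightarrow> \<bar>f x\<bar> \<le> B" for f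
  proof -
    have *: "- B \<le> - f x" "- f x \<le> B" if "x \<in> space M" for x
      using \<open>\<And>x. x \<in> space M \<Longrightarrow> \<bar>f x\<bar> \<le> B\<close>[OF that] by linarith+
    show int: "integrable M (\<lambda>x. exp (- f x))"
      using * by (intro integrable_bounded[where B = "exp B"]) auto
    show "exp (- B) \<le> expectation (\<lambda>x. exp (- f x))"
      using * int by (intro integral_ge_const AE_I2) auto
    show "expectation (\<lambda>x. exp (- f x)) \<le> exp B"
      using * int by (intro integral_le_const AE_I2) auto
  qed
  have Z: "exp (- B) \<le> Z" "Z \<le> exp B" and Z': "exp (- B) \<le> Z'" "Z' \<le> exp B"
    unfolding Z_def Z'_def using exp_range meas bound by blast+
  have pos: "0 < Z" "0 < Z'"
    using Z(1) Z'(1) less_le_trans[OF exp_gt_zero] by blast+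
  \<comment> \<open>These bounds keep the normalised exponents
    \<open>- (\<Psi> x + ln Z) / 2\<close> at most \<open>B\<close>.\<close>
  have ln_ge: "- B \<le> ln Z" "- B \<le> ln Z'"
    using Z(1) Z'(1) pos by (simp_all add: ln_ge_iff)
  have "\<bar>Z - Z'\<bar> = \<bar>expectation (\<lambda>x. exp (- \<Psi> x) - exp (- \<Psi>' x))\<bar>"
    unfolding Z_def Z'_def using int_exp meas bound by simp
  also have "\<dots> \<le> expectation (\<lambda>x. \<bar>exp (- \<Psi> x) - exp (- \<Psi>' x)\<bar>)"
    by (rule integral_abs_bound)
  also have "\<dots> \<le> expectation (\<lambda>x. exp B * \<bar>\<Psi> x - \<Psi>' x\<bar>)"
  proof (rule integral_mono)
    show "integrable M (\<lambda>x. \<bar>exp (- \<Psi> x) - exp (- \<Psi>' x)\<bar>)"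
      using int_exp meas bound by (intro integrable_abs Bochner_Integration.integrable_diff) blast+
    show "integrable M (\<lambda>x. exp B * \<bar>\<Psi> x - \<Psi>' x\<bar>)"
      using int_diff by simp
    show "\<bar>exp (- \<Psi> x) - exp (- \<Psi>' x)\<bar> \<le> exp B * \<bar>\<Psi> x - \<Psi>' x\<bar>" if "x \<in> space M" for x
      using abs_exp_diff_le[of "- \<Psi> x" B "- \<Psi>' x"] bound[OF that] by (simp add: abs_if split: if_splits)
  qed
  also have "\<dots> = exp B * I"
    by (simp add: I_def)
  finally have Z_diff: "\<bar>Z - Z'\<bar> \<le> exp B * I" .
  \<comment> \<open>Both constants are at least \<open>exp (- B)\<close>, so the logarithm
    contributes a second factor \<open>exp B\<close>.\<close>
  have "\<bar>ln Z - ln Z'\<bar> \<le> \<bar>Z - Z'\<bar> / exp (- B)"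
    using Z Z' by (intro abs_ln_diff_le) auto
  also have "\<dots> \<le> exp B * I / exp (- B)"
    using Z_diff by (intro divide_right_mono) auto
  also have "\<dots> = exp (2 * B) * I"
    by (simp add: exp_minus field_simps flip: exp_add)
  finally have ln_diff: "\<bar>ln Z - ln Z'\<bar> \<le> exp (2 * B) * I" .
  \<comment> \<open>The normalising constant enters the exponent as \<open>ln c\<close>, and the
    square root halves the exponent.\<close>
  have sqrt_exp: "sqrt (exp (- p) / c) = exp (- (p + ln c) / 2)" if "c > 0" for p c :: real
  proof (rule real_sqrt_unique)
    have "(exp (- (p + ln c) / 2))\<^sup>2 = exp (- p - ln c)"
      by (simp add: power2_eq_square flip: exp_add)
    then show "(exp (- (p + ln c) / 2))\<^sup>2 = exp (- p) / c"
      using that by (simp add: exp_diff)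
  qed simp
  have pointwise: "(sqrt (exp (- \<Psi> x) / Z) - sqrt (exp (- \<Psi>' x) / Z'))\<^sup>2
      \<le> exp (2 * B) * ((\<Psi> x - \<Psi>' x)\<^sup>2 + exp (4 * B) * I\<^sup>2)" if x: "x \<in> space M" for x
  proof -
    let ?a = "\<bar>\<Psi> x - \<Psi>' x\<bar>" and ?b = "exp (2 * B) * I"
    have "\<bar>sqrt (exp (- \<Psi> x) / Z) - sqrt (exp (- \<Psi>' x) / Z')\<bar>
        \<le> exp B * \<bar>- (\<Psi> x + ln Z) / 2 - - (\<Psi>' x + ln Z') / 2\<bar>"
      unfolding sqrt_exp[OF pos(1)] sqrt_exp[OF pos(2)]
      using bound[OF x] ln_ge by (intro abs_exp_diff_le) (auto simp: field_simps abs_le_iff)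
    also have "\<dots> \<le> exp B * ((?a + ?b) / 2)"
      using ln_diff by (intro mult_left_mono) (auto simp: abs_if field_simps split: if_splits)
    finally have "(sqrt (exp (- \<Psi> x) / Z) - sqrt (exp (- \<Psi>' x) / Z'))\<^sup>2
        \<le> (exp B * ((?a + ?b) / 2))\<^sup>2"
      by (metis abs_ge_zero power2_abs power_mono)
    also have "\<dots> = exp (2 * B) * ((?a + ?b) / 2)\<^sup>2"
      by (simp only: power_mult_distrib exp_double)
    also have "\<dots> \<le> exp (2 * B) * (?a\<^sup>2 + ?b\<^sup>2)"
    proof (intro mult_left_mono)
      \<comment> \<open>Parallelogram identity. It would give half of the sum of squares; the factor
        one half is given away.\<close>
      have "((?a + ?b) / 2)\<^sup>2 + ((?a - ?b) / 2)\<^sup>2 = (?a\<^sup>2 + ?b\<^sup>2) / 2"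
        by (simp add: power2_eq_square field_simps del: abs_mult_self_eq)
      moreover have "(0::real) \<le> ((?a - ?b) / 2)\<^sup>2" "0 \<le> ?a\<^sup>2" "0 \<le> ?b\<^sup>2"
        by simp_all
      ultimately show "((?a + ?b) / 2)\<^sup>2 \<le> ?a\<^sup>2 + ?b\<^sup>2"
        by argo
    qed simp
    also have "?a\<^sup>2 + ?b\<^sup>2 = (\<Psi> x - \<Psi>' x)\<^sup>2 + exp (4 * B) * I\<^sup>2"
      by (simp add: power_mult_distrib flip: exp_double)
    finally show ?thesis .
  qed
  \<comment> \<open>Only the majorant is shown to be integrable. Since it is nonnegative, the bound
    also covers the default value 0 of an undefined integral on the left.\<close>
  have "expectation (\<lambda>x. (sqrt (exp (- \<Psi> x) / Z) - sqrt (exp (- \<Psi>' x) / Z'))\<^sup>2)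
      \<le> expectation (\<lambda>x. exp (2 * B) * ((\<Psi> x - \<Psi>' x)\<^sup>2 + exp (4 * B) * I\<^sup>2))"
    using int_diff2 pointwise by (intro integral_mono') auto
  also have "\<dots> = exp (2 * B) * (expectation (\<lambda>x. (\<Psi> x - \<Psi>' x)\<^sup>2) + exp (4 * B) * I\<^sup>2)"
    using int_diff2 by (simp add: prob_space)
  also have "\<dots> \<le> exp (2 * B) * (expectation (\<lambda>x. (\<Psi> x - \<Psi>' x)\<^sup>2)
      + exp (4 * B) * expectation (\<lambda>x. (\<Psi> x - \<Psi>' x)\<^sup>2))"
    using square_expectation_le[OF int_diff] int_diff2 by (simp add: I_def)
  finally show ?thesis
    by (simp add: algebra_simps)
qed

section \<open>From densities on \<open>U\<close> to the Hellinger distance of posteriors\<close>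

text \<open>Potentials are measurable only on \<open>U\<close>, so the estimates are made on the
  restricted space, which is a probability space once \<open>U\<close> has mass one.\<close>

lemma set_integral_eq_integral_restrict_space:
  fixes f :: "'a \<Rightarrow> real"
  assumes "U \<in> sets M"
  shows "(LINT u:U|M. f u) = integral\<^sup>L (restrict_space M U) f"
  using assms by (simp add: set_lebesgue_integral_def integral_restrict_space)

text \<open>Almost everywhere on \<open>U\<close> the Radon-Nikodym derivatives are the explicit
  densities, so the integral estimate on the restricted space applies. The factor one half in the
  Hellinger distance ends up under the root.\<close>

lemma hellinger_dist_posterior_le:
  fixes \<Psi> \<Psi>' :: "'u \<Rightarrow> real" and B :: real
  assumes prob: "prob_space M" and U [measurable]: "U \<in> sets M" and U1: "measure M U = 1"
    and meas: "\<Psi> \<in> borel_measurable (restrict_space M U)" "\<Psi>' \<in> borel_measurable (restrict_space M U)"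
    and bound: "\<And>u. u \<in> U \<Longrightarrow> \<bar>\<Psi> u\<bar> \<le> B" "\<And>u. u \<in> U \<Longrightarrow> \<bar>\<Psi>' u\<bar> \<le> B"
  shows "hellinger_dist U M (posterior U M \<Psi>) (posterior U M \<Psi>')
    \<le> sqrt (exp (2 * B) * (1 + exp (4 * B)) / 2) * L2_norm_on U M (\<lambda>u. \<Psi> u - \<Psi>' u)"
proof -
  interpret M: prob_space M by fact
  interpret R: prob_space "restrict_space M U"
    using U U1 by (intro prob_space_restrict_space) (auto simp: M.emeasure_eq_measure)
  have space_R: "space (restrict_space M U) = U"
    using sets.sets_into_space[OF U] by (auto simp: space_restrict_space)
  have RN: "AE u in M. u \<in> U \<longrightarrow>
      enn2real (RN_deriv M (posterior U M f) u) = exp (- f u) / norm_const U M f"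
    if f: "f \<in> borel_measurable (restrict_space M U)" for f
  proof -
    have "(\<lambda>u. 1 / norm_const U M f * exp (- f u)) \<in> borel_measurable (restrict_space M U)"
      using f by measurable
    \<comment> \<open>The indicator extends the density by zero, which turns measurability on
      \<open>U\<close> into measurability on the whole space.\<close>
    then have [measurable]: "(\<lambda>u. indicator U u * (1 / norm_const U M f * exp (- f u)))
        \<in> borel_measurable M"
      by (subst (asm) borel_measurable_restrict_space_iff) auto
    \<comment> \<open>\<open>ennreal\<close> sends negative reals to 0, so this sign is what lets
      \<open>enn2real\<close> recover the density.\<close>
    have nonneg: "0 \<le> norm_const U M f"
      unfolding norm_const_def set_integral_eq_integral_restrict_space[OF U] by simp
    have "AE u in M. ennreal (indicator U u * (1 / norm_const U M f * exp (- f u)))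
        = RN_deriv M (posterior U M f) u"
      by (rule M.RN_deriv_unique) (measurable, simp only: posterior_def)
    then show ?thesis
    proof eventually_elim
      case (elim u)
      show ?case
        using nonneg by (auto simp flip: elim)
    qed
  qed
  let ?H = "\<lambda>u. (sqrt (exp (- \<Psi> u) / norm_const U M \<Psi>) - sqrt (exp (- \<Psi>' u) / norm_const U M \<Psi>'))\<^sup>2"
  have "?H \<in> borel_measurable (restrict_space M U)"
    using meas by measurable
  then have [measurable]: "(\<lambda>u. indicator U u *\<^sub>R ?H u) \<in> borel_measurable M"
    by (subst (asm) borel_measurable_restrict_space_iff) auto
  have "(LINT u:U|M. (sqrt (enn2real (RN_deriv M (posterior U M \<Psi>) u))
      - sqrt (enn2real (RN_deriv M (posterior U M \<Psi>') u)))\<^sup>2) = (LINT u:U|M. ?H u)"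
    unfolding set_lebesgue_integral_def
  proof (intro integral_cong_AE)
    show "AE u in M. indicat_real U u *\<^sub>R (sqrt (enn2real (RN_deriv M (posterior U M \<Psi>) u))
        - sqrt (enn2real (RN_deriv M (posterior U M \<Psi>') u)))\<^sup>2 = indicat_real U u *\<^sub>R ?H u"
      using RN[OF meas(1)] RN[OF meas(2)] by eventually_elim (auto simp: indicator_def)
  qed measurable
  also have "\<dots> \<le> exp (2 * B) * (1 + exp (4 * B)) * (LINT u:U|M. (\<Psi> u - \<Psi>' u)\<^sup>2)"
    unfolding norm_const_def set_integral_eq_integral_restrict_space[OF U]
    using meas bound by (intro R.hellinger_integral_le) (auto simp: space_R)
  finally show ?thesis
    by (simp add: hellinger_dist_def L2_norm_on_def flip: real_sqrt_mult)
qed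

section \<open>Invertible Gram matrices and measurable emulators\<close>

text \<open>A nonzero null vector of the Gram matrix would give coefficients on the design points
  whose quadratic form vanishes, against strict positive definiteness. The dimensions of the inverse
  are recorded in order to expand the scalar product in \<open>gp_mean\<close>.\<close>

lemma gram_matrix_inverse:
  assumes kernel: "posdef_kernel_on U k" and d: "inj_on d {..<N}" "d ` {..<N} \<subseteq> U"
  obtains B where "mat_inverse (gram_matrix k N d) = Some B" "B \<in> carrier_mat N N"
proof -
  let ?K = "gram_matrix k N d"
  have K: "?K \<in> carrier_mat N N"
    by (simp add: gram_matrix_def)
  have "det ?K \<noteq> 0"
  proof
    assume "det ?K = 0"
    then obtain v where v: "v \<in> carrier_vec N" "v \<noteq> 0\<^sub>v N" "?K *\<^sub>v v = 0\<^sub>v N"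
      using det_0_iff_vec_prod_zero_field[OF K] by blast
    \<comment> \<open>Entries of \<open>v\<close> are indexed by numbers, kernel coefficients by
      points; injectivity of \<open>d\<close> makes this transfer well defined.\<close>
    let ?c = "\<lambda>u. vec_index v (the_inv_into {..<N} d u)"
    have c: "?c (d i) = vec_index v i" if "i < N" for i
      using d(1) that by (simp add: the_inv_into_f_f)
    obtain i where i: "i < N" "vec_index v i \<noteq> 0"
      using v(1,2) by (metis carrier_vecD eq_vecI index_zero_vec)
    have row: "(\<Sum>j<N. k (d i) (d j) * vec_index v j) = 0" if "i < N" for i
    proof -
      have "(\<Sum>j<N. k (d i) (d j) * vec_index v j) = vec_index (?K *\<^sub>v v) i"
        using that v(1) by (auto simp: gram_matrix_def scalar_prod_def atLeast0LessThan)
      then show ?thesis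
        using v(3) that by simp
    qed
    have "(\<Sum>u\<in>d ` {..<N}. \<Sum>w\<in>d ` {..<N}. ?c u * ?c w * k u w)
        = (\<Sum>i<N. \<Sum>j<N. vec_index v i * vec_index v j * k (d i) (d j))"
      by (simp add: sum.reindex[OF d(1)] c)
    also have "\<dots> = (\<Sum>i<N. vec_index v i * (\<Sum>j<N. k (d i) (d j) * vec_index v j))"
      by (simp add: sum_distrib_left mult_ac)
    also have "\<dots> = 0"
      by (simp add: row)
    finally have "(\<Sum>u\<in>d ` {..<N}. \<Sum>w\<in>d ` {..<N}. ?c u * ?c w * k u w) = 0" .
    moreover have "(\<Sum>u\<in>d ` {..<N}. \<Sum>w\<in>d ` {..<N}. ?c u * ?c w * k u w) > 0"
    proof -
      have "\<exists>a\<in>d ` {..<N}. ?c a \<noteq> 0"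
        using i c by auto
      then show ?thesis
        using kernel[unfolded posdef_kernel_on_def, THEN conjunct2, rule_format,
            of "d ` {..<N}" ?c] d(2) by blast
    qed
    ultimately show False
      by simp
  qed
  then have "?K \<in> Units (ring_mat TYPE(real) N ())"
    by (rule det_non_zero_imp_unit[OF K])
  then obtain B where B: "mat_inverse ?K = Some B"
    using mat_inverse(1)[OF K, where b = "()"] by (cases "mat_inverse ?K") auto
  moreover have "B \<in> carrier_mat N N"
    using mat_inverse(2)[OF K B] by blast
  ultimately show thesis
    by (rule that)
qed

text \<open>The section is the joint kernel composed with the continuous embedding
  \<open>\<lambda>u. (u, v)\<close>.\<close>

lemma measurable_kernel_section:
  fixes k :: "'u::second_countable_topology \<Rightarrow> 'u \<Rightarrow> real"
  assumes "(\<lambda>(u, v). k u v) \<in> borel_measurable (restrict_space borel (U \<times> U))" "v \<in> U"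
  shows "(\<lambda>u. k u v) \<in> borel_measurable (restrict_space borel U)"
proof -
  have "(\<lambda>u. (u, v)) \<in> restrict_space borel U \<rightarrow>\<^sub>M restrict_space borel (U \<times> U)"
    using assms(2)
    by (intro measurable_restrict_space3 borel_measurable_continuous_onI continuous_intros) auto
  from measurable_compose[OF this assms(1)] show ?thesis
    by simp
qed

text \<open>In \<open>u\<close>, the predictive mean is \<open>m\<close> plus a linear combination
  of kernel sections whose weights \<open>?w\<close> are fixed; \<open>g\<close> enters only through
  its values at the design points.\<close>

lemma measurable_gp_mean:
  fixes m :: "'u::second_countable_topology \<Rightarrow> real"
  assumes "m \<in> borel_measurable (restrict_space borel U)"
    and "(\<lambda>(u, v). k u v) \<in> borel_measurable (restrict_space borel (U \<times> U))"
    and kernel: "posdef_kernel_on U k" and d: "inj_on d {..<N}" "d ` {..<N} \<subseteq> U"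
  shows "gp_mean m k N d g \<in> borel_measurable (restrict_space borel U)"
proof -
  obtain B where B: "mat_inverse (gram_matrix k N d) = Some B" "B \<in> carrier_mat N N"
    using gram_matrix_inverse[OF kernel d] .
  let ?w = "B *\<^sub>v (Matrix.vec N (\<lambda>n. g (d n)) - Matrix.vec N (\<lambda>n. m (d n)))"
  have "gp_mean m k N d g = (\<lambda>u. m u + (\<Sum>i<N. k u (d i) * vec_index ?w i))"
    using B by (auto simp: gp_mean_def scalar_prod_def atLeast0LessThan fun_eq_iff)
  moreover have "(\<lambda>u. k u (d i)) \<in> borel_measurable (restrict_space borel U)" if "i < N" for i
    using that d(2) by (intro measurable_kernel_section[OF assms(2)]) auto
  ultimately show ?thesis
    using assms(1)
    by (simp only:) (intro borel_measurable_add borel_measurable_sum borel_measurable_times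
        borel_measurable_const, simp_all)
qed

lemma measurable_gp_mean_vec:
  fixes m :: "'u::second_countable_topology \<Rightarrow> real" and G :: "'u \<Rightarrow> real ^ 'n"
  assumes "\<And>g. gp_mean m k N d g \<in> borel_measurable M"
  shows "gp_mean_vec m k N d G \<in> borel_measurable M"
  unfolding borel_measurable_euclidean_space[of "gp_mean_vec m k N d G"]
  using assms by (auto simp: Basis_vec_def gp_mean_vec_def inner_axis)

section \<open>The misfit as a quadratic form\<close>

lemma measurable_misfit:
  fixes F :: "'u \<Rightarrow> real ^ 'n"
  assumes "F \<in> borel_measurable M"
  shows "misfit \<Gamma> y F \<in> borel_measurable M"
proof -
  have "(\<lambda>x. 1 / 2 * weighted_norm_sq \<Gamma> (y - x)) \<in> borel_measurable borel"
    unfolding weighted_norm_sq_def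
    by (intro borel_measurable_continuous_onI continuous_intros
        linear_continuous_on_compose[OF _ matrix_vector_mul_linear])
  from measurable_compose[OF assms this] show ?thesis
    by (simp add: misfit_def[abs_def])
qed

text \<open>\<open>L\<close> is half an operator norm bound for the inverse of
  \<open>\<Gamma>\<close>. It depends on neither the data nor the map nor the point, which later
  makes the constants independent of \<open>N\<close>.\<close>

lemma misfit_estimates:
  fixes \<Gamma> :: "real ^ 'n ^ 'n"
  obtains L where "0 \<le> L"
    and "\<And>y (F :: 'u \<Rightarrow> real ^ 'n) u. \<bar>misfit \<Gamma> y F u\<bar> \<le> L * (norm (y - F u))\<^sup>2"
    and "\<And>y (F :: 'u \<Rightarrow> real ^ 'n) F' u. \<bar>misfit \<Gamma> y F u - misfit \<Gamma> y F' u\<bar>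
      \<le> L * (norm (y - F u) + norm (y - F' u)) * norm (F u - F' u)"
proof -
  let ?A = "matrix_inv \<Gamma>"
  obtain K where K: "0 < K" "\<And>x. norm (?A *v x) \<le> norm x * K"
    using bounded_linear.pos_bounded[OF matrix_vector_mul_bounded_linear[of ?A]] by blast
  have form_le: "\<bar>inner a (?A *v b)\<bar> \<le> K * norm a * norm b" for a b
  proof -
    have "\<bar>inner a (?A *v b)\<bar> \<le> norm a * norm (?A *v b)"
      by (rule Cauchy_Schwarz_ineq2)
    also have "\<dots> \<le> norm a * (norm b * K)"
      using K(2) by (intro mult_left_mono) auto
    finally show ?thesis
      by (simp add: mult_ac)
  qed
  show thesis
  proof (rule that[of "K / 2"])
    show "0 \<le> K / 2"
      using K(1) by simp
    show "\<bar>misfit \<Gamma> y F u\<bar> \<le> K / 2 * (norm (y - F u))\<^sup>2" for y and F :: "'u \<Rightarrow> _" and u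
      using form_le[of "y - F u" "y - F u"]
      by (simp add: misfit_def weighted_norm_sq_def power2_eq_square abs_mult mult_ac)
    show "\<bar>misfit \<Gamma> y F u - misfit \<Gamma> y F' u\<bar>
        \<le> K / 2 * (norm (y - F u) + norm (y - F' u)) * norm (F u - F' u)"
      for y and F F' :: "'u \<Rightarrow> _" and u
    proof -
      let ?a = "y - F u" and ?b = "y - F' u"
      \<comment> \<open>Telescoping: the two arguments of the bilinear form are changed one at a
        time.\<close>
      have "inner ?a (?A *v ?a) - inner ?b (?A *v ?b)
          = inner ?a (?A *v (?a - ?b)) + inner (?a - ?b) (?A *v ?b)"
        by (simp only: matrix_vector_mult_diff_distrib inner_diff_left inner_diff_right)
      also have "\<bar>\<dots>\<bar> \<le> K * norm ?a * norm (?a - ?b) + K * norm (?a - ?b) * norm ?b"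
        by (rule order_trans[OF abs_triangle_ineq add_mono[OF form_le form_le]])
      also have "norm (?a - ?b) = norm (F u - F' u)"
        by (simp add: norm_minus_commute)
      finally have "\<bar>inner ?a (?A *v ?a) - inner ?b (?A *v ?b)\<bar> / 2
          \<le> K / 2 * (norm ?a + norm ?b) * norm (F u - F' u)"
        by (simp add: algebra_simps)
      then show ?thesis
        unfolding misfit_def weighted_norm_sq_def right_diff_distrib[symmetric] abs_mult by simp
    qed
  qed
qed

section \<open>Hellinger bounds for the two emulated posteriors\<close>

theorem theorem5p1:
  fixes U :: "(real ^ 'u) set"
    and \<mu>0 :: "(real ^ 'u) measure"
    and G :: "real ^ 'u \<Rightarrow> real ^ 'y"
    and y :: "real ^ 'y"
    and \<Gamma> :: "real ^ 'y ^ 'y"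
    and R S :: "(real ^ 't) set"
    and m :: "real ^ 't \<Rightarrow> real ^ 'u \<Rightarrow> real"
    and k :: "real ^ 't \<Rightarrow> real ^ 'u \<Rightarrow> real ^ 'u \<Rightarrow> real"
    and D :: "nat \<Rightarrow> nat \<Rightarrow> real ^ 'u"
    and \<theta> :: "nat \<Rightarrow> real ^ 't"
    and CG :: real
  defines "\<Phi> \<equiv> misfit \<Gamma> y G"
    and "mG \<equiv> \<lambda>N. gp_mean_vec (m (\<theta> N)) (k (\<theta> N)) N (D N) G"
    and "m\<Phi> \<equiv> \<lambda>N. gp_mean (m (\<theta> N)) (k (\<theta> N)) N (D N) (misfit \<Gamma> y G)"
  assumes noise: "posdef_matrix \<Gamma>"
    and prior: "prob_space \<mu>0" "sets \<mu>0 = sets borel" "measure \<mu>0 U = 1"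
    and meas_G: "G \<in> borel_measurable (restrict_space borel U)"
    and meas_m: "\<And>t. t \<in> R \<Longrightarrow> m t \<in> borel_measurable (restrict_space borel U)"
    and meas_k: "\<And>t. t \<in> R \<Longrightarrow>
          (\<lambda>(u, v). k t u v) \<in> borel_measurable (restrict_space borel (U \<times> U))"
    and kernel: "\<And>t. t \<in> R \<Longrightarrow> posdef_kernel_on U (k t)"
    and design: "\<And>N. N \<ge> 1 \<Longrightarrow> inj_on (D N) {..<N}" "\<And>N. N \<ge> 1 \<Longrightarrow> D N ` {..<N} \<subseteq> U"
    and params: "compact S" "S \<subseteq> R" "\<And>N. N \<ge> 1 \<Longrightarrow> \<theta> N \<in> S"
    and U_compact: "compact U"
    and bounded_G_err: "\<exists>B. \<forall>N\<ge>1. \<forall>u\<in>U. norm (G u - mG N u) \<le> B"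
    and bounded_Phi_err: "\<exists>B. \<forall>N\<ge>1. \<forall>u\<in>U. \<bar>\<Phi> u - m\<Phi> N u\<bar> \<le> B"
    and bounded_G: "\<And>u. u \<in> U \<Longrightarrow> norm (G u) \<le> CG"
  shows "\<exists>C1 C2. \<forall>N\<ge>1.
      hellinger_dist U \<mu>0 (posterior U \<mu>0 \<Phi>) (posterior U \<mu>0 (misfit \<Gamma> y (mG N)))
        \<le> C1 * L2_norm_on U \<mu>0 (\<lambda>u. G u - mG N u) \<and>
      hellinger_dist U \<mu>0 (posterior U \<mu>0 \<Phi>) (posterior U \<mu>0 (m\<Phi> N))
        \<le> C2 * L2_norm_on U \<mu>0 (\<lambda>u. \<Phi> u - m\<Phi> N u)"
proof -
  let ?P = "restrict_space \<mu>0 U"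
  have U: "U \<in> sets \<mu>0"
    using U_compact prior(2) by (simp add: borel_compact)
  interpret \<mu>0: prob_space \<mu>0
    by (rule prior(1))
  interpret P: prob_space ?P
    using U prior(3) by (intro prob_space_restrict_space) (auto simp: \<mu>0.emeasure_eq_measure)
  have space_P: "space ?P = U"
    using sets.sets_into_space[OF U] by (auto simp: space_restrict_space)
  have meas_P: "borel_measurable ?P = borel_measurable (restrict_space borel U)"
    by (intro measurable_cong_sets sets_restrict_space_cong prior(2) refl)
  have gp [measurable]: "gp_mean (m (\<theta> N)) (k (\<theta> N)) N (D N) g \<in> borel_measurable ?P"
    if "N \<ge> 1" for N g
    unfolding meas_P using params(2) params(3)[OF that] design[OF that] meas_m meas_k kernel
    by (intro measurable_gp_mean) auto
  have meas_\<Phi>: "\<Phi> \<in> borel_measurable ?P"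
    unfolding \<Phi>_def meas_P by (rule measurable_misfit[OF meas_G])
  have meas_m\<Phi>: "m\<Phi> N \<in> borel_measurable ?P" if "N \<ge> 1" for N
    unfolding m\<Phi>_def by (rule gp[OF that])
  have meas_mG: "mG N \<in> borel_measurable ?P" if "N \<ge> 1" for N
    unfolding mG_def by (rule measurable_gp_mean_vec[OF gp[OF that]])
  obtain BG where BG: "\<And>N u. N \<ge> 1 \<Longrightarrow> u \<in> U \<Longrightarrow> norm (G u - mG N u) \<le> BG"
    using bounded_G_err by blast
  obtain B\<Phi> where B\<Phi>: "\<And>N u. N \<ge> 1 \<Longrightarrow> u \<in> U \<Longrightarrow> \<bar>\<Phi> u - m\<Phi> N u\<bar> \<le> B\<Phi>"
    using bounded_Phi_err by blast
  obtain L where L: "0 \<le> L"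
    and misfit_le: "\<And>F (u :: real ^ 'u). \<bar>misfit \<Gamma> y F u\<bar> \<le> L * (norm (y - F u))\<^sup>2"
    and misfit_diff_le: "\<And>F F' (u :: real ^ 'u). \<bar>misfit \<Gamma> y F u - misfit \<Gamma> y F' u\<bar>
      \<le> L * (norm (y - F u) + norm (y - F' u)) * norm (F u - F' u)"
    using misfit_estimates[of \<Gamma>] by metis
  \<comment> \<open>A common radius for the residuals of the true and the emulated map, with
    \<open>\<bar>BG\<bar>\<close> reserved for the emulation error. The absolute values give
    \<open>0 \<le> r\<close> whatever the signs of \<open>CG\<close> and \<open>BG\<close>.\<close>
  define r where "r = norm y + \<bar>CG\<bar> + \<bar>BG\<bar>"
  have r: "0 \<le> r"
    by (simp add: r_def)
  have yG: "norm (y - G u) \<le> r" if "u \<in> U" for u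
    using norm_triangle_ineq4[of y "G u"] bounded_G[OF that] unfolding r_def by linarith
  have ymG: "norm (y - mG N u) \<le> r" if "N \<ge> 1" "u \<in> U" for N u
  proof -
    have "norm (y - mG N u) \<le> norm (y - G u) + norm (G u - mG N u)"
      using norm_triangle_ineq[of "y - G u" "G u - mG N u"] by simp
    \<comment> \<open>The bound \<open>r\<close> from \<open>yG\<close> would be too large here,
      since the emulation error is still to be added.\<close>
    also have "norm (y - G u) \<le> norm y + \<bar>CG\<bar>"
      using norm_triangle_ineq4[of y "G u"] bounded_G[OF that(2)] by linarith
    finally show ?thesis
      using BG[OF that] unfolding r_def by linarith
  qed
  have misfit_bound: "\<bar>misfit \<Gamma> y F u\<bar> \<le> L * r\<^sup>2" if "norm (y - F u) \<le> r"
    for F and u :: "real ^ 'u"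
    using misfit_le[of F u] mult_left_mono[OF power_mono[OF that norm_ge_zero, of 2] L]
    by linarith
  have \<Phi>_bound: "\<bar>\<Phi> u\<bar> \<le> L * r\<^sup>2" if "u \<in> U" for u
    unfolding \<Phi>_def using yG[OF that] by (rule misfit_bound)
  \<comment> \<open>The constant of \<open>hellinger_dist_posterior_le\<close> for potentials
    bounded by \<open>B\<close>.\<close>
  let ?C = "\<lambda>B. sqrt (exp (2 * B) * (1 + exp (4 * B)) / 2)"
  have hell_G: "hellinger_dist U \<mu>0 (posterior U \<mu>0 \<Phi>) (posterior U \<mu>0 (misfit \<Gamma> y (mG N)))
      \<le> ?C (L * r\<^sup>2) * (2 * L * r) * L2_norm_on U \<mu>0 (\<lambda>u. G u - mG N u)" if N: "N \<ge> 1" for N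
  proof -
    \<comment> \<open>The Lipschitz constant \<open>2 * L * r\<close> arises as
      \<open>L * (r + r)\<close>. Its square is moved into the integral so that the integrands can
      be compared pointwise.\<close>
    have "L2_norm_on U \<mu>0 (\<lambda>u. \<Phi> u - misfit \<Gamma> y (mG N) u)
        \<le> sqrt ((2 * L * r)\<^sup>2 * (LINT u:U|\<mu>0. (norm (G u - mG N u))\<^sup>2))"
      unfolding L2_norm_on_def set_integral_eq_integral_restrict_space[OF U]
        Bochner_Integration.integral_mult_right_zero[symmetric]
    proof (intro real_sqrt_le_mono integral_mono')
      have "(\<lambda>u. (norm (G u - mG N u))\<^sup>2) \<in> borel_measurable ?P"
        using meas_G meas_mG[OF N] unfolding meas_P by measurable
      then show "integrable ?P (\<lambda>u. (2 * L * r)\<^sup>2 * (norm (G u - mG N u))\<^sup>2)"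
        using BG[OF N] by (intro integrable_mult_right P.integrable_bounded[where B = "BG\<^sup>2"])
          (auto simp: space_P power_mono)
    next
      fix u assume "u \<in> space ?P"
      then have u: "u \<in> U"
        by (simp add: space_P)
      have "\<bar>\<Phi> u - misfit \<Gamma> y (mG N) u\<bar>
          \<le> L * (norm (y - G u) + norm (y - mG N u)) * norm (G u - mG N u)"
        unfolding \<Phi>_def by (rule misfit_diff_le)
      also have "\<dots> \<le> L * (r + r) * norm (G u - mG N u)"
        using L yG[OF u] ymG[OF N u] by (intro mult_right_mono mult_left_mono add_mono) auto
      finally have "\<bar>\<Phi> u - misfit \<Gamma> y (mG N) u\<bar> \<le> 2 * L * r * norm (G u - mG N u)"
        by simp
      from power_mono[OF this abs_ge_zero, of 2]
      show "(norm (\<Phi> u - misfit \<Gamma> y (mG N) u))\<^sup>2 \<le> (2 * L * r)\<^sup>2 * (norm (G u - mG N u))\<^sup>2"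
        by (simp add: power_mult_distrib)
    qed simp
    also have "\<dots> = (2 * L * r) * L2_norm_on U \<mu>0 (\<lambda>u. G u - mG N u)"
      using L r by (simp add: L2_norm_on_def real_sqrt_mult)
    finally have L2_le: "L2_norm_on U \<mu>0 (\<lambda>u. \<Phi> u - misfit \<Gamma> y (mG N) u)
        \<le> 2 * L * r * L2_norm_on U \<mu>0 (\<lambda>u. G u - mG N u)" .
    have "hellinger_dist U \<mu>0 (posterior U \<mu>0 \<Phi>) (posterior U \<mu>0 (misfit \<Gamma> y (mG N)))
        \<le> ?C (L * r\<^sup>2) * L2_norm_on U \<mu>0 (\<lambda>u. \<Phi> u - misfit \<Gamma> y (mG N) u)"
      using measurable_misfit[OF meas_mG[OF N]] \<Phi>_bound misfit_bound[OF ymG[OF N]]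
      by (intro hellinger_dist_posterior_le[OF prior(1) U prior(3) meas_\<Phi>])
    also have "\<dots> \<le> ?C (L * r\<^sup>2) * (2 * L * r * L2_norm_on U \<mu>0 (\<lambda>u. G u - mG N u))"
      using L2_le by (rule mult_left_mono) simp
    finally show ?thesis
      by (simp only: mult.assoc)
  qed
  have hell_\<Phi>: "hellinger_dist U \<mu>0 (posterior U \<mu>0 \<Phi>) (posterior U \<mu>0 (m\<Phi> N))
      \<le> ?C (L * r\<^sup>2 + \<bar>B\<Phi>\<bar>) * L2_norm_on U \<mu>0 (\<lambda>u. \<Phi> u - m\<Phi> N u)" if N: "N \<ge> 1" for N
  proof -
    \<comment> \<open>The emulated potential is bounded by the true one plus the uniform emulation
      error.\<close>
    have "\<bar>\<Phi> u\<bar> \<le> L * r\<^sup>2 + \<bar>B\<Phi>\<bar>" "\<bar>m\<Phi> N u\<bar> \<le> L * r\<^sup>2 + \<bar>B\<Phi>\<bar>" if "u \<in> U" for u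
      using \<Phi>_bound[OF that] B\<Phi>[OF N that] by linarith+
    then show ?thesis
      by (rule hellinger_dist_posterior_le[OF prior(1) U prior(3) meas_\<Phi> meas_m\<Phi>[OF N]])
  qed
  show ?thesis
    \<comment> \<open>The factors in both bounds involve only \<open>L\<close>, \<open>r\<close> and
      \<open>B\<Phi>\<close>, all fixed before \<open>N\<close>.\<close>
    using hell_G hell_\<Phi> by blast
qed

end
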